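(* For all $k\geq 3$, $AR_{FF}(C_k) = \frac{k^2}{8}(1+o(1))$, where $C_k$ is the cycle with $k$ edges and $o(1)$ is a function of $k$ tending to $0$ as $k\to\infty$.
   Context: All graphs are finite and simple. An edge-colored graph is rainbow if all its edges have distinct colors. A copy of $H$ is a (not necessarily induced) subgraph isomorphic to $H$. $AR_{FF}(H)$ (First-Fit anti-Ramsey number): Builder presents vertices and edges of a simple graph, one edge at a time, and each new edge is immediately colored by Painter with the smallest color in $\{1,2,\ldots\}$ not used on an adjacent edge already presented (First-Fit). $AR_{FF}(H)$ is the smallest $t$ such that Builder can present $t$ edges so that the resulting colored graph contains a rainbow copy of $H$. *)

theory Defs
  imports Complex_Main "HOL-Library.Extended_Real"
begin

record 'v ugraph =
  verts :: "'v set"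
  edges :: "'v set set"

definition simple_graph :: "'v ugraph \<Rightarrow> bool" where
  "simple_graph G \<longleftrightarrow> finite (verts G) \<and> (\<forall>e\<in>edges G. e \<subseteq> verts G \<and> card e = 2)"

definition subgraph :: "'v ugraph \<Rightarrow> 'v ugraph \<Rightarrow> bool" where
  "subgraph S G \<longleftrightarrow> simple_graph S \<and> verts S \<subseteq> verts G \<and> edges S \<subseteq> edges G"

definition isomorphic :: "'v ugraph \<Rightarrow> 'w ugraph \<Rightarrow> bool" where
  "isomorphic G H \<longleftrightarrow>
     (\<exists>f. bij_betw f (verts G) (verts H) \<and> edges H = (\<lambda>e. f ` e) ` edges G)"

definition is_copy :: "'v ugraph \<Rightarrow> 'w ugraph \<Rightarrow> 'v ugraph \<Rightarrow> bool" where
  "is_copy S H G \<longleftrightarrow> subgraph S G \<and> isomorphic S H"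

text \<open>Edge colorings are partial maps: \<open>None\<close> means that the edge has not been presented (yet).\<close>

definition rainbow :: "('v set \<rightharpoonup> nat) \<Rightarrow> 'v ugraph \<Rightarrow> bool" where
  "rainbow c G \<longleftrightarrow> edges G \<subseteq> dom c \<and> inj_on c (edges G)"

definition adjacent_edges :: "'v set \<Rightarrow> 'v set \<Rightarrow> bool" where
  "adjacent_edges e f \<longleftrightarrow> e \<noteq> f \<and> e \<inter> f \<noteq> {}"

definition first_fit_color :: "('v set \<rightharpoonup> nat) \<Rightarrow> 'v set \<Rightarrow> nat" where
  "first_fit_color c e = (LEAST q. 1 \<le> q \<and> (\<forall>f. adjacent_edges e f \<longrightarrow> c f \<noteq> Some q))"

text \<open>The list holds the edges in the order in which Builder presents them.\<close>

definition first_fit_coloring :: "'v set list \<Rightarrow> ('v set \<rightharpoonup> nat)" where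
  "first_fit_coloring es = fold (\<lambda>e c. c(e \<mapsto> first_fit_color c e)) es Map.empty"

text \<open>
  Host graphs live on \<^typ>\<open>nat\<close>, which up to isomorphism covers all finite graphs.
  The infimum in \<^typ>\<open>enat\<close> is a minimum, and is \<open>\<infinity>\<close> if Builder can never force a rainbow copy.
\<close>

definition AR_FF :: "'w ugraph \<Rightarrow> enat" where
  "AR_FF H = Inf {enat (length es) | es.
     distinct es \<and>
     (\<exists>G :: nat ugraph. simple_graph G \<and> edges G = set es \<and>
        (\<exists>S. is_copy S H G \<and> rainbow (first_fit_coloring es) S))}"

definition cycle_graph :: "nat \<Rightarrow> nat ugraph" where
  "cycle_graph k = \<lparr>verts = {..<k}, edges = {{i, (i + 1) mod k} | i. i < k}\<rparr>"

end

theory Submission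
  imports Defs "HOL-Library.Nat_Bijection"
begin

text \<open>
  Lower bound: an edge \<open>uv\<close> of color \<open>c\<close> is adjacent to edges of all smaller colors, so
  \<open>deg u + deg v \<ge> c + 1\<close>. Summing over the \<open>k\<close> distinct colors of a rainbow \<open>C\<^sub>k\<close> counts every degree
  on the cycle twice, and the handshake lemma turns this into at least \<open>k\<^sup>2 / 8\<close> edges.

  Upper bound: if every edge of a properly colored graph is adjacent to edges of all smaller colors,
  then First-Fit reproduces the coloring when the edges come in order of color. Such a
  coloring with a rainbow \<open>C\<^sub>k\<close>, \<open>k = N + 2\<close>, lives on a path \<open>0, \<dots>, N\<close>. Call \<open>v < N\<close> a hub if \<open>N + v\<close>
  is odd, and join each hub \<open>y\<close> to all \<open>x \<le> y - 2\<close> with \<open>x + y \<ge> N\<close>, in color \<open>x + y + 1 - N\<close>: about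
  \<open>N\<^sup>2 / 8\<close> edges. The hub then sees all colors up to \<open>2 y - 1 - N\<close>, so these edges are adjacent to all
  smaller colors. Beyond that threshold a vertex \<open>v\<close> sees the colors up to \<open>v\<close> of its own parity, so
  consecutive path vertices complement each other and the path edge from \<open>v\<close> to \<open>v + 1\<close> can
  get color \<open>v + 2\<close>. A bounded number of pendant edges per hub fills the gap around the threshold,
  and one more vertex \<open>N + 1\<close> with \<open>N + 1\<close> pendant edges closes the cycle.
\<close>

section \<open>First-Fit colorings\<close>

lemma first_fit_coloring_Nil [simp]: "first_fit_coloring [] = Map.empty"
  by (simp add: first_fit_coloring_def)

text \<open>When \<open>e\<close> is presented, minimality of the \<open>LEAST\<close> color puts
  every smaller color on an adjacent edge; distinctness of \<open>es\<close> means that no edge is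
  recolored afterwards.\<close>

lemma first_fit_coloring_snoc [simp]:
  "first_fit_coloring (es @ [e]) =
     (first_fit_coloring es)(e \<mapsto> first_fit_color (first_fit_coloring es) e)"
  by (simp add: first_fit_coloring_def)

lemma dom_first_fit_coloring: "dom (first_fit_coloring es) = set es"
  by (induction es rule: rev_induct) (simp_all del: fun_upd_apply)

lemma first_fit_coloring_greedy:
  assumes "distinct es" "first_fit_coloring es e = Some c" "1 \<le> q" "q < c"
  shows "\<exists>f. adjacent_edges e f \<and> first_fit_coloring es f = Some q"
  using assms(1,2)
proof (induction es rule: rev_induct)
  case Nil
  then show ?case by simp
next
  case (snoc a es)
  let ?c = "first_fit_coloring es"
  have notin: "a \<notin> dom ?c"
    using snoc.prems by (simp add: dom_first_fit_coloring)
  have "\<exists>f. adjacent_edges e f \<and> ?c f = Some q"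
  proof (cases "e = a")
    case True
    then have "q < first_fit_color ?c a"
      using snoc.prems assms(4) by simp
    then show ?thesis
      using assms(3) True unfolding first_fit_color_def by (blast dest: not_less_Least)
  next
    case False
    then show ?thesis using snoc by simp
  qed
  then show ?case using notin by (metis domI first_fit_coloring_snoc fun_upd_other)
qed

text \<open>When the last edge arrives, all edges of smaller color are already colored, so every
  color below the prescribed one is blocked. The prescribed color is free, because edges sharing a
  color are disjoint.\<close>

lemma first_fit_coloring_sorted:
  assumes "distinct ps" "sorted (map snd ps)"
    and "\<And>e c d. (e, c) \<in> set ps \<Longrightarrow> (e, d) \<in> set ps \<Longrightarrow> c = d"
    and "\<And>e f c. (e, c) \<in> set ps \<Longrightarrow> (f, c) \<in> set ps \<Longrightarrow> e \<inter> f \<noteq> {} \<Longrightarrow> e = f"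
    and "\<And>e c. (e, c) \<in> set ps \<Longrightarrow> 1 \<le> c"
    and "\<And>e c q. (e, c) \<in> set ps \<Longrightarrow> 1 \<le> q \<Longrightarrow> q < c \<Longrightarrow>
           \<exists>f. (f, q) \<in> set ps \<and> adjacent_edges e f"
  shows "first_fit_coloring (map fst ps) e = Some c \<longleftrightarrow> (e, c) \<in> set ps"
  using assms
proof (induction ps arbitrary: e c rule: rev_induct)
  case Nil
  then show ?case by simp
next
  case (snoc p ps)
  obtain a k where p: "p = (a, k)" by force
  let ?c = "first_fit_coloring (map fst ps)"
  have le: "d \<le> k" if "(f, d) \<in> set ps" for f d
    using snoc.prems(2) that by (auto simp: sorted_append p)
  have anew: "(a, d) \<notin> set ps" for d
    using snoc.prems(1) snoc.prems(3)[of a d k] by (auto simp: p)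
  have greedy: "\<exists>f. (f, q) \<in> set ps \<and> adjacent_edges f' f"
    if "(f', d) \<in> set (ps @ [p])" "1 \<le> q" "q < d" for f' d q
  proof -
    have "\<exists>f. (f, q) \<in> set (ps @ [p]) \<and> adjacent_edges f' f"
      using snoc.prems(6)[OF that] .
    then obtain f where f: "(f, q) \<in> set (ps @ [p])" "adjacent_edges f' f"
      by blast
    \<comment> \<open>The color \<open>q\<close> lies below \<open>d\<close>, hence below the
      largest color \<open>k\<close>, so the blocking edge is not the last one.\<close>
    have "(f, q) \<noteq> p"
      using that le by (fastforce simp: p)
    with f show ?thesis by auto
  qed
  have IH: "?c f = Some d \<longleftrightarrow> (f, d) \<in> set ps" for f d
  proof (rule snoc.IH)
    show "distinct ps" "sorted (map snd ps)"
      using snoc.prems(1,2) by (auto simp: sorted_append)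
    show "c = d" if "(e, c) \<in> set ps" "(e, d) \<in> set ps" for e c d
      using snoc.prems(3) that by auto
    show "e = f" if "(e, c) \<in> set ps" "(f, c) \<in> set ps" "e \<inter> f \<noteq> {}" for e f c
      using snoc.prems(4)[of e c f] that by auto
    show "1 \<le> c" if "(e, c) \<in> set ps" for e c
      using snoc.prems(5) that by auto
    show "\<exists>f. (f, q) \<in> set ps \<and> adjacent_edges e f"
      if "(e, c) \<in> set ps" "1 \<le> q" "q < c" for e c q
      using greedy[of e c q] that by auto
  qed
  have "first_fit_color ?c a = k"
    unfolding first_fit_color_def
  proof (rule Least_equality)
    have "?c f \<noteq> Some k" if "adjacent_edges a f" for f
      using snoc.prems(4)[of a k f] that by (auto simp: IH p adjacent_edges_def)
    then show "1 \<le> k \<and> (\<forall>f. adjacent_edges a f \<longrightarrow> ?c f \<noteq> Some k)"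
      using snoc.prems(5)[of a k] by (auto simp: p)
    show "k \<le> q" if "1 \<le> q \<and> (\<forall>f. adjacent_edges a f \<longrightarrow> ?c f \<noteq> Some q)" for q
    proof (rule ccontr)
      assume "\<not> k \<le> q"
      then show False using greedy[of a k q] that by (auto simp: p IH)
    qed
  qed
  then show ?case using anew by (auto simp: p IH)
qed

lemma first_fit_coloring_realize:
  fixes D :: "('v set \<times> nat) set"
  assumes "finite D"
    and sv: "\<And>e c d. (e, c) \<in> D \<Longrightarrow> (e, d) \<in> D \<Longrightarrow> c = d"
    and "\<And>e f c. (e, c) \<in> D \<Longrightarrow> (f, c) \<in> D \<Longrightarrow> e \<inter> f \<noteq> {} \<Longrightarrow> e = f"
    and "\<And>e c. (e, c) \<in> D \<Longrightarrow> 1 \<le> c"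
    and "\<And>e c q. (e, c) \<in> D \<Longrightarrow> 1 \<le> q \<Longrightarrow> q < c \<Longrightarrow> \<exists>f. (f, q) \<in> D \<and> adjacent_edges e f"
  obtains es where "distinct es" "set es = fst ` D" "length es = card D"
    "\<And>e c. first_fit_coloring es e = Some c \<longleftrightarrow> (e, c) \<in> D"
proof -
  obtain ps0 where ps0: "set ps0 = D" "distinct ps0"
    using finite_distinct_list[OF assms(1)] by blast
  define ps where "ps = sort_key snd ps0"
  have ps: "set ps = D" "distinct ps" "sorted (map snd ps)"
    by (simp_all add: ps_def ps0)
  show thesis
  proof (rule that)
    have "inj_on fst D" using sv by (force simp: inj_on_def)
    then show "distinct (map fst ps)" by (simp add: distinct_map ps)
    show "set (map fst ps) = fst ` D" by (simp add: ps)
    show "length (map fst ps) = card D"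
      using ps by (metis distinct_card length_map)
    show "first_fit_coloring (map fst ps) e = Some c \<longleftrightarrow> (e, c) \<in> D" for e c
      by (rule first_fit_coloring_sorted[OF ps(2,3), unfolded ps(1)]) (fact assms)+
  qed
qed

section \<open>The lower bound\<close>

text \<open>Adjacent edges lie in the star of \<open>u\<close> or of \<open>v\<close>; removing
  \<open>{u, v}\<close> itself from both stars accounts for the 2.\<close>

lemma card_adjacent_edges:
  assumes "finite E" "{u, v} \<in> E"
  shows "card {f \<in> E. adjacent_edges {u, v} f} + 2 \<le> card {f \<in> E. u \<in> f} + card {f \<in> E. v \<in> f}"
proof -
  let ?U = "{f \<in> E. u \<in> f}" and ?V = "{f \<in> E. v \<in> f}"
  have "{f \<in> E. adjacent_edges {u, v} f} \<subseteq> (?U - {{u, v}}) \<union> (?V - {{u, v}})"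
    by (auto simp: adjacent_edges_def)
  then have "card {f \<in> E. adjacent_edges {u, v} f} \<le> card ((?U - {{u, v}}) \<union> (?V - {{u, v}}))"
    using assms(1) by (intro card_mono) auto
  also have "\<dots> \<le> card (?U - {{u, v}}) + card (?V - {{u, v}})"
    by (rule card_Un_le)
  finally have "card {f \<in> E. adjacent_edges {u, v} f} \<le> card (?U - {{u, v}}) + card (?V - {{u, v}})" .
  moreover have "card (?U - {{u, v}}) + 1 = card ?U" "card (?V - {{u, v}}) + 1 = card ?V"
    using assms card.remove[of ?U "{u, v}"] card.remove[of ?V "{u, v}"] by auto
  ultimately show ?thesis by linarith
qed

lemma first_fit_color_le_degrees:
  assumes "distinct es" "first_fit_coloring es {u, v} = Some c"
  shows "c + 1 \<le> card {f \<in> set es. u \<in> f} + card {f \<in> set es. v \<in> f}"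
proof -
  let ?c = "first_fit_coloring es" and ?A = "{f \<in> set es. adjacent_edges {u, v} f}"
  have "{1..<c} \<subseteq> (\<lambda>f. the (?c f)) ` ?A"
  proof
    fix q assume "q \<in> {1..<c}"
    then obtain f where f: "adjacent_edges {u, v} f" "?c f = Some q"
      using first_fit_coloring_greedy[OF assms] by auto
    then have "f \<in> set es"
      using dom_first_fit_coloring[of es] by auto
    with f show "q \<in> (\<lambda>f. the (?c f)) ` ?A" by force
  qed
  then have "card {1..<c} \<le> card ?A" by (rule surj_card_le[rotated]) simp
  moreover have "{u, v} \<in> set es"
    using assms(2) dom_first_fit_coloring[of es] by auto
  ultimately show ?thesis
    using card_adjacent_edges[of "set es" u v] by simp
qed

text \<open>Adding the values in increasing order, each new one is at least the number of those
  before it.\<close>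

lemma sum_inj_on_ge:
  fixes c :: "nat \<Rightarrow> nat"
  assumes "inj_on c {..<k}"
  shows "(\<Sum>i<k. i) \<le> (\<Sum>i<k. c i)"
proof -
  have "\<Sum>{..<card A} \<le> \<Sum>A" if "finite A" for A :: "nat set"
    using that
  proof (induction A rule: finite_linorder_max_induct)
    case empty
    then show ?case by simp
  next
    case (insert b A)
    then have "A \<subseteq> {..<b}" by auto
    then have "card A \<le> b" using subset_eq_atLeast0_lessThan_card[of A b] by (simp add: lessThan_atLeast0)
    with insert show ?case by auto
  qed
  from this[of "c ` {..<k}"] show ?thesis
    using assms by (simp add: card_image sum.reindex)
qed

lemma sum_cyclic_shift:
  fixes f :: "nat \<Rightarrow> nat"
  assumes "k > 0"
  shows "(\<Sum>i<k. f ((i + 1) mod k)) = (\<Sum>i<k. f i)"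
proof -
  obtain m where k: "k = Suc m" using assms gr0_implies_Suc by blast
  have "(\<Sum>i<m. f ((i + 1) mod k)) = (\<Sum>i<m. f (Suc i))"
    by (intro sum.cong) (auto simp: k)
  then show ?thesis
    using sum.lessThan_Suc_shift[of f m] unfolding k by (simp add: k)
qed

lemma handshake_le:
  assumes "finite E" "finite W" "\<And>f. f \<in> E \<Longrightarrow> card f = 2"
  shows "(\<Sum>v\<in>W. card {f \<in> E. v \<in> f}) \<le> 2 * card E"
proof -
  have "(\<Sum>v\<in>W. card {f \<in> E. v \<in> f}) = (\<Sum>f\<in>E. card {v \<in> W. v \<in> f})"
    using sum_multicount_gen[of W E "\<lambda>v f. v \<in> f" "\<lambda>f. card {v \<in> W. v \<in> f}"] assms by simp
  also have "\<dots> \<le> (\<Sum>f\<in>E. 2)"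
  proof (rule sum_mono)
    fix f assume "f \<in> E"
    then have f: "card f = 2" using assms by simp
    then have "finite f" using card.infinite by fastforce
    then have "card {v \<in> W. v \<in> f} \<le> card f" by (intro card_mono) auto
    with f show "card {v \<in> W. v \<in> f} \<le> 2" by simp
  qed
  finally show ?thesis by (simp add: mult.commute)
qed

lemma inj_on_cycle_edges:
  fixes k :: nat
  assumes "k \<ge> 3"
  shows "inj_on (\<lambda>i. {i, (i + 1) mod k}) {..<k}"
proof (rule inj_onI)
  fix i j assume ij: "i \<in> {..<k}" "j \<in> {..<k}" "{i, (i + 1) mod k} = {j, (j + 1) mod k}"
  show "i = j"
  proof (rule ccontr)
    assume "i \<noteq> j"
    \<comment> \<open>Equal edges at different positions must have swapped ends, so \<open>i\<close>
      would equal \<open>i + 2\<close> modulo \<open>k\<close>, which fails for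
      \<open>k \<ge> 3\<close>.\<close>
    then have "j = (i + 1) mod k" "i = (j + 1) mod k"
      using ij(3) by (auto simp: doubleton_eq_iff)
    then show False using ij(1,2) assms \<open>i \<noteq> j\<close>
      by (auto simp: mod_Suc split: if_splits)
  qed
qed

text \<open>Inverting the isomorphism numbers the vertices of the copy in cyclic order, so that sums
  along the cycle become sums over \<open>i < k\<close>.\<close>

lemma cycle_copy_vertices:
  assumes "isomorphic S (cycle_graph k)"
    and "\<And>e. e \<in> edges S \<Longrightarrow> e \<subseteq> verts S"
  obtains g where "inj_on g {..<k}"
    "\<And>i. i < k \<Longrightarrow> {g i, g ((i + 1) mod k)} \<in> edges S"
proof -
  obtain f where f: "bij_betw f (verts S) {..<k}"
    and E: "{{i, (i + 1) mod k} | i. i < k} = (\<lambda>e. f ` e) ` edges S"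
    using assms(1) by (auto simp: isomorphic_def cycle_graph_def)
  define g where "g = inv_into (verts S) f"
  have g: "bij_betw g {..<k} (verts S)"
    unfolding g_def by (rule bij_betw_inv_into[OF f])
  show thesis
  proof (rule that)
    show "inj_on g {..<k}" using g by (rule bij_betw_imp_inj_on)
    show "{g i, g ((i + 1) mod k)} \<in> edges S" if "i < k" for i
    proof -
      have "{i, (i + 1) mod k} \<in> (\<lambda>e. f ` e) ` edges S"
        unfolding E[symmetric] using that by blast
      then obtain e where e: "e \<in> edges S" "f ` e = {i, (i + 1) mod k}" by auto
      have "g ` (f ` e) = e"
        using assms(2)[OF e(1)] bij_betw_imp_inj_on[OF f]
        unfolding g_def by (simp add: inv_into_image_cancel)
      then show ?thesis using e by simp
    qed
  qed
qed

lemma rainbow_cycle_lower_bound: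
  fixes G :: "nat ugraph"
  assumes "k \<ge> 3" "distinct es" "simple_graph G" "edges G = set es"
    and "is_copy S (cycle_graph k) G" "rainbow (first_fit_coloring es) S"
  shows "k\<^sup>2 \<le> 8 * length es"
proof -
  have sub: "edges S \<subseteq> set es" and iso: "isomorphic S (cycle_graph k)"
    and ss: "\<And>e. e \<in> edges S \<Longrightarrow> e \<subseteq> verts S"
    using assms(4,5) by (auto simp: is_copy_def subgraph_def simple_graph_def)
  obtain g where g: "inj_on g {..<k}" "\<And>i. i < k \<Longrightarrow> {g i, g ((i + 1) mod k)} \<in> edges S"
    using cycle_copy_vertices[OF iso ss] by blast
  let ?e = "\<lambda>i. {g i, g ((i + 1) mod k)}" and ?c = "first_fit_coloring es"
  define d where "d v = card {f \<in> set es. v \<in> f}" for v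
  define c where "c i = the (?c (?e i))" for i
  have c: "?c (?e i) = Some (c i)" if "i < k" for i
    proof -
    have "?e i \<in> dom ?c" using g(2)[OF that] sub dom_first_fit_coloring[of es] by blast
    then show ?thesis unfolding c_def by (metis domD option.sel)
  qed
  have "inj_on ?e {..<k}"
  proof (rule inj_onI)
    fix i j assume ij: "i \<in> {..<k}" "j \<in> {..<k}" "?e i = ?e j"
    have "g ` {i, (i + 1) mod k} = g ` {j, (j + 1) mod k}" using ij(3) by simp
    then have "{i, (i + 1) mod k} = {j, (j + 1) mod k}"
      using inj_on_image_eq_iff[OF g(1)] ij(1,2) by (metis (no_types, lifting) assms(1) empty_subsetI gr_zeroI insert_subset lessThan_iff mod_less_divisor not_numeral_le_zero)
    then show "i = j" using inj_on_cycle_edges[OF assms(1)] ij(1,2) by (auto dest: inj_onD)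
  qed
  have "inj_on c {..<k}"
  proof (rule inj_onI)
    fix i j assume ij: "i \<in> {..<k}" "j \<in> {..<k}" "c i = c j"
    then have "?c (?e i) = ?c (?e j)" using c by simp
    then have "?e i = ?e j"
      using assms(6) g(2) ij(1,2) unfolding rainbow_def by (auto dest: inj_onD)
    then show "i = j" using \<open>inj_on ?e {..<k}\<close> ij(1,2) by (auto dest: inj_onD)
  qed
  \<comment> \<open>The chain reads \<open>k (k + 1) / 2 \<le> 2 * (degree sum on the cycle) \<le> 4
    * length es\<close>.\<close>
  have "(\<Sum>i<k. i + 1) \<le> (\<Sum>i<k. c i + 1)"
    using sum_inj_on_ge[OF \<open>inj_on c {..<k}\<close>] unfolding sum.distrib by simp
  also have "\<dots> \<le> (\<Sum>i<k. d (g i) + d (g ((i + 1) mod k)))"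
    using first_fit_color_le_degrees[OF assms(2) c] by (intro sum_mono) (simp add: d_def)
  also have "\<dots> = 2 * (\<Sum>i<k. d (g i))"
    using sum_cyclic_shift[of k "\<lambda>i. d (g i)"] assms(1) by (simp add: sum.distrib)
  also have "(\<Sum>i<k. d (g i)) = (\<Sum>v\<in>g ` {..<k}. d v)"
    using g(1) by (simp add: sum.reindex)
  also have "2 * \<dots> \<le> 2 * (2 * length es)"
    using handshake_le[of "set es" "g ` {..<k}"] assms(2,3,4)
    unfolding d_def by (simp add: simple_graph_def distinct_card)
  finally have "(\<Sum>i<k. i + 1) \<le> 4 * length es" by simp
  moreover have "k\<^sup>2 \<le> 2 * (\<Sum>i<k. i + 1)"
    by (induction k) (auto simp: power2_eq_square)
  ultimately show ?thesis by simp
qed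

section \<open>The upper bound\<close>

text \<open>
  \<open>pendant N v c\<close> asks for a leaf at \<open>v\<close> joined in color \<open>c\<close>. At a hub \<open>v\<close>, color \<open>c\<close> of a hub edge leads to
  \<open>c + N - 1 - v\<close>; offsets \<open>0, 1, 2, 4\<close> would lead to \<open>v - 1, v, v + 1, v + 3\<close>, which are not available,
  while offset \<open>3\<close> leads to the hub \<open>v + 2\<close>.
\<close>

definition pendant :: "nat \<Rightarrow> nat \<Rightarrow> nat \<Rightarrow> bool" where
  "pendant N v c \<longleftrightarrow> v = 0 \<and> c = 1 \<or> v = N + 1 \<and> 1 \<le> c \<and> c \<le> N + 1 \<or>
     v < N \<and> odd (N + v) \<and> 1 \<le> c \<and> c \<le> v \<and> c + N \<in> {2 * v, 2 * v + 1, 2 * v + 2, 2 * v + 4}"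

text \<open>The pairing function gives each pair \<open>(v, c)\<close> its own vertex; the shift by
  \<open>N + 2\<close> keeps it off the cycle \<open>0, ..., N + 1\<close>.\<close>

definition leaf :: "nat \<Rightarrow> nat \<Rightarrow> nat \<Rightarrow> nat" where
  "leaf N v c = N + 2 + prod_encode (v, c)"

text \<open>These are the edges of the rainbow cycle: the path uses the colors
  \<open>2, ..., N + 1\<close>, and the two edges at \<open>N + 1\<close> use \<open>N + 2\<close>
  and \<open>N + 3\<close>.\<close>

definition path_edge :: "nat \<Rightarrow> nat \<Rightarrow> nat \<Rightarrow> nat \<Rightarrow> bool" where
  "path_edge N x y c \<longleftrightarrow> y = x + 1 \<and> y \<le> N \<and> c = x + 2 \<or>
     y = N + 1 \<and> (x = 0 \<and> c = N + 2 \<or> x = N \<and> c = N + 3)"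

text \<open>The end \<open>y\<close> is the hub. The color depends on \<open>x + y\<close> only, so
  at a fixed vertex it determines the other end.\<close>

definition hub_edge :: "nat \<Rightarrow> nat \<Rightarrow> nat \<Rightarrow> nat \<Rightarrow> bool" where
  "hub_edge N x y c \<longleftrightarrow> x + 1 < y \<and> y < N \<and> odd (N + y) \<and> N \<le> x + y \<and> c + N = x + y + 1"

text \<open>Every edge is oriented from its smaller to its larger end, a leaf being larger than all
  cycle vertices; \<open>col_adj\<close> forgets the orientation.\<close>

definition col_edge :: "nat \<Rightarrow> nat \<Rightarrow> nat \<Rightarrow> nat \<Rightarrow> bool" where
  "col_edge N x y c \<longleftrightarrow> path_edge N x y c \<or> hub_edge N x y c \<or> pendant N x c \<and> y = leaf N x c"

definition col_adj :: "nat \<Rightarrow> nat \<Rightarrow> nat \<Rightarrow> nat \<Rightarrow> bool" where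
  "col_adj N x y c \<longleftrightarrow> col_edge N x y c \<or> col_edge N y x c"

section \<open>Properness of the coloring\<close>

lemma leaf_eq_iff [simp]: "leaf N v c = leaf N w d \<longleftrightarrow> v = w \<and> c = d"
  by (simp add: leaf_def)

lemma leaf_gt: "N + 1 < leaf N v c"
  by (simp add: leaf_def)

lemma pendant_le: "pendant N v c \<Longrightarrow> v \<le> N + 1"
  by (auto simp: pendant_def)

lemma col_edge_less: "N > 0 \<Longrightarrow> col_edge N x y c \<Longrightarrow> x < y \<and> x \<le> N + 1"
  using leaf_gt[of N x c] pendant_le[of N x c]
  by (auto simp: col_edge_def path_edge_def hub_edge_def)

lemma col_edge_pos: "col_edge N x y c \<Longrightarrow> 1 \<le> c"
  by (auto simp: col_edge_def path_edge_def hub_edge_def pendant_def)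

lemma col_edge_fun:
  assumes "N > 0" "col_edge N x y c" "col_edge N x y d"
  shows "c = d"
  using assms leaf_gt[of N x c] leaf_gt[of N x d]
  by (auto simp: col_edge_def path_edge_def hub_edge_def)

lemma hub_edge_color:
  "hub_edge N v w c \<or> hub_edge N w v c \<Longrightarrow> c \<le> v \<and> c + N = v + w + 1"
  by (auto simp: hub_edge_def)

lemma path_edge_color:
  "path_edge N v w c \<or> path_edge N w v c \<Longrightarrow> v < c"
  by (auto simp: path_edge_def)

lemma path_edge_proper:
  assumes "N > 0" "path_edge N v w c \<or> path_edge N w v c" "path_edge N v u c \<or> path_edge N u v c"
  shows "w = u"
  using assms unfolding path_edge_def by (elim disjE conjE; simp)

text \<open>At \<open>v\<close>, hub edges have colors at most \<open>v\<close> and path edges have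
  colors above \<open>v\<close>, so the two kinds never clash; within each kind the color determines
  the other end.\<close>

lemma inner_proper:
  assumes "N > 0" "path_edge N v w c \<or> path_edge N w v c \<or> hub_edge N v w c \<or> hub_edge N w v c"
    "path_edge N v u c \<or> path_edge N u v c \<or> hub_edge N v u c \<or> hub_edge N u v c"
  shows "w = u"
  using assms path_edge_proper[of N v w c u] path_edge_color[of N v w c] path_edge_color[of N v u c]
    hub_edge_color[of N v w c] hub_edge_color[of N v u c] by linarith

lemma inner_pendant:
  assumes "N > 0" "path_edge N v w c \<or> path_edge N w v c \<or> hub_edge N v w c \<or> hub_edge N w v c"
  shows "\<not> pendant N v c"
proof
  assume p: "pendant N v c"
  show False
  proof (cases "hub_edge N v w c \<or> hub_edge N w v c")
    case False
    then have "path_edge N v w c \<or> path_edge N w v c" using assms(2) by blast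
    \<comment> \<open>A pendant color exceeds its vertex only at \<open>0\<close>, where it is 1 and
      the path edges have other colors.\<close>
    then have "v < c" "v = 0 \<Longrightarrow> c \<noteq> 1"
      using path_edge_color[of N v w c] assms(1) by (auto simp: path_edge_def)
    then show False using p by (auto simp: pendant_def)
  next
    case True
    then have c: "c \<le> v" "c + N = v + w + 1" "v < N"
      using hub_edge_color[OF True] True unfolding hub_edge_def by linarith+
    consider "v = 0" "c = 1" | "v = N + 1"
      | "odd (N + v)" "c + N \<in> {2 * v, 2 * v + 1, 2 * v + 2, 2 * v + 4}"
      using p unfolding pendant_def by blast
    then show False
    proof cases
      case 3
      \<comment> \<open>In the first three cases \<open>w\<close> is too close to \<open>v\<close>;
        in the last, \<open>v + 3\<close> would have to be the hub of the edge but has the wrong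
        parity.\<close>
      then have "w + 1 = v \<or> w = v \<or> w = v + 1 \<or> w = v + 3"
        using c(2) unfolding insert_iff empty_iff by presburger
      moreover have "v + 1 < w \<and> odd (N + w) \<or> w + 1 < v"
        using True unfolding hub_edge_def by blast
      ultimately show False using \<open>odd (N + v)\<close> by auto
    qed (use c in linarith)+
  qed
qed

lemma inner_le:
  assumes "N > 0" "path_edge N v w c \<or> path_edge N w v c \<or> hub_edge N v w c \<or> hub_edge N w v c"
  shows "v \<le> N + 1"
  using assms unfolding path_edge_def hub_edge_def by linarith

text \<open>Leaves lie above \<open>N + 1\<close> and have only one edge. At a vertex up to
  \<open>N + 1\<close>, pendants avoid the colors of path and hub edges, and vertex and color
  determine the leaf.\<close>

lemma col_adj_proper:
  assumes "N > 0" "col_adj N v w c" "col_adj N v u c"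
  shows "w = u"
proof -
  let ?I = "\<lambda>v w. path_edge N v w c \<or> path_edge N w v c \<or> hub_edge N v w c \<or> hub_edge N w v c"
  have cases: "?I v x \<or> pendant N v c \<and> x = leaf N v c \<or> pendant N x c \<and> v = leaf N x c"
    if "col_adj N v x c" for x
    using that by (auto simp: col_adj_def col_edge_def)
  consider "?I v w" | "pendant N v c" "w = leaf N v c" | "pendant N w c" "v = leaf N w c"
    using cases[OF assms(2)] by blast
  then show ?thesis
  proof cases
    case 1
    then have "\<not> pendant N v c" "v \<le> N + 1"
      using inner_pendant[OF assms(1)] inner_le[OF assms(1)] by blast+
    then have "?I v u"
      using cases[OF assms(3)] leaf_gt[of N u c] by force
    with 1 show ?thesis using inner_proper[OF assms(1)] by blast
  next
    case 2
    then have "\<not> ?I v u" "v \<le> N + 1"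
      using inner_pendant[OF assms(1)] pendant_le by blast+
    with 2 show ?thesis
      using cases[OF assms(3)] leaf_gt[of N u c] by force
  next
    case 3
    then have "N + 1 < v" using leaf_gt by simp
    then have "\<not> ?I v u" "\<not> pendant N v c"
      using inner_le[OF assms(1), of v u c] pendant_le[of N v c] by linarith+
    with 3 show ?thesis using cases[OF assms(3)] by auto
  qed
qed

section \<open>Every edge is adjacent to all smaller colors\<close>

lemma hub_saturated:
  assumes "v < N" "odd (N + v)" "1 \<le> q" "q \<le> v" "q + N \<le> 2 * v + 4"
  shows "\<exists>u. col_adj N v u q"
proof -
  \<comment> \<open>Smaller partners give the colors up to \<open>2 * v - 1 - N\<close>. The offsets
    0 to 4 of \<open>q + N\<close> from \<open>2 * v\<close> come from pendants, except 3, which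
    comes from the hub \<open>v + 2\<close>.\<close>
  consider "q + N \<in> {2 * v, 2 * v + 1, 2 * v + 2, 2 * v + 4}" | "q + N = 2 * v + 3"
    | "q + N + 1 \<le> 2 * v"
  proof -
    have "q + N \<in> {2 * v, 2 * v + 1, 2 * v + 2, 2 * v + 4} \<or> q + N = 2 * v + 3 \<or> q + N + 1 \<le> 2 * v"
      using assms(5) unfolding insert_iff empty_iff by linarith
    then show ?thesis using that by blast
  qed
  then show ?thesis
  proof cases
    case 1
    then have "pendant N v q" using assms by (simp add: pendant_def)
    then show ?thesis by (auto simp: col_adj_def col_edge_def)
  next
    case 2
    then have "hub_edge N v (v + 2) q" using assms by (auto simp: hub_edge_def)
    then show ?thesis by (auto simp: col_adj_def col_edge_def)
  next
    case 3
    then have "hub_edge N (q + N - 1 - v) v q" using assms by (auto simp: hub_edge_def)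
    then show ?thesis by (auto simp: col_adj_def col_edge_def)
  qed
qed

text \<open>Here \<open>v\<close> is the lower end: the partner \<open>q + N - 1 - v\<close> exceeds
  \<open>v + 1\<close> above the threshold, stays below \<open>N\<close> since
  \<open>q \<le> v\<close>, and is a hub exactly when \<open>q\<close> and \<open>v\<close> have the
  same parity.\<close>

lemma lower_colors:
  assumes "v \<le> N" "even (q + v)" "1 \<le> q" "q \<le> v" "2 * v + 2 < q + N"
  shows "\<exists>u. col_adj N v u q"
proof -
  have "hub_edge N v (q + N - 1 - v) q"
    using assms unfolding hub_edge_def by auto
  then show ?thesis by (auto simp: col_adj_def col_edge_def)
qed

lemma pendant_col_adj: "pendant N v q \<Longrightarrow> \<exists>u. col_adj N v u q"
  by (auto simp: col_adj_def col_edge_def)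

lemma path_greedy:
  assumes "x < N" "1 \<le> q" "q \<le> x + 1"
  shows "\<exists>u. col_adj N x u q \<or> col_adj N (x + 1) u q"
proof (cases "q = x + 1")
  case True
  show ?thesis
  proof (cases "x = 0")
    case True
    then have "pendant N x q" using \<open>q = x + 1\<close> by (simp add: pendant_def)
    then show ?thesis using pendant_col_adj by blast
  next
    case False
    then have "path_edge N (x - 1) x q" using assms True by (auto simp: path_edge_def)
    then show ?thesis by (auto simp: col_adj_def col_edge_def)
  qed
next
  case False
  then have q: "q \<le> x" using assms by simp
  \<comment> \<open>Up to the threshold, a hub among \<open>x\<close> and \<open>x + 1\<close> sees
    \<open>q\<close>; above it, the one with the parity of \<open>q\<close> does. The constant 4 is
    what \<open>lower_colors\<close> requires at \<open>x + 1\<close>.\<close>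
  consider "q + N \<le> 2 * x + 4" "odd (N + x)" | "q + N \<le> 2 * x + 4" "even (N + x)" "x + 1 < N"
    | "2 * x + 4 < q + N" "even (q + x)" | "2 * x + 4 < q + N" "odd (q + x)"
  proof -
    \<comment> \<open>The vertex \<open>N\<close> is never a hub, but for \<open>x + 1 = N\<close>
      the vertex \<open>x\<close> is one.\<close>
    have "x + 1 < N" if "even (N + x)"
      using assms(1) that by presburger
    then show ?thesis using that by (meson not_less)
  qed
  then show ?thesis
  proof cases
    case 1
    then show ?thesis using hub_saturated[of x N q] assms q by auto
  next
    case 2
    then show ?thesis using hub_saturated[of "x + 1" N q] assms q by auto
  next
    case 3
    then show ?thesis using lower_colors[of x N q] assms q by auto
  next
    case 4
    then show ?thesis using lower_colors[of "x + 1" N q] assms q by auto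
  qed
qed

lemma col_edge_greedy:
  assumes "N > 0" "col_edge N x y c" "1 \<le> q" "q < c"
  shows "\<exists>u. col_adj N x u q \<or> col_adj N y u q"
proof -
  consider "path_edge N x y c" "y \<le> N" | "path_edge N x y c" "y = N + 1"
    | "hub_edge N x y c" | "pendant N x c"
    using assms(2) by (auto simp: col_edge_def path_edge_def)
  then show ?thesis
  proof cases
    case 1
    then show ?thesis using path_greedy[of x N q] assms by (auto simp: path_edge_def)
  next
    case 2
    show ?thesis
    proof (cases "q \<le> N + 1")
      case True
      then have "pendant N y q" using 2 assms by (simp add: pendant_def)
      then show ?thesis using pendant_col_adj by blast
    next
      case False
      \<comment> \<open>Only \<open>q = N + 2\<close> is left, the color of the edge between
        \<open>0\<close> and \<open>N + 1\<close>.\<close>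
      then have "path_edge N 0 y q" using 2 assms by (auto simp: path_edge_def)
      then show ?thesis by (auto simp: col_adj_def col_edge_def)
    qed
  next
    case 3
    \<comment> \<open>From \<open>x \<le> y - 2\<close> follows
      \<open>c + N \<le> 2 * y - 1\<close>, so the hub \<open>y\<close> alone sees all smaller
      colors.\<close>
    then show ?thesis
      using hub_saturated[of y N q] assms by (auto simp: hub_edge_def)
  next
    case 4
    then consider "x = N + 1" "q \<le> N + 1" | "x < N" "odd (N + x)" "q \<le> x" "q + N \<le> 2 * x + 4"
      using assms by (auto simp: pendant_def)
    then show ?thesis
    proof cases
      case 1
      then have "pendant N x q" using assms by (simp add: pendant_def)
      then show ?thesis using pendant_col_adj by blast
    next
      case 2
      then show ?thesis using hub_saturated[of x N q] assms by auto
    qed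
  qed
qed

section \<open>The colored edge set and its size\<close>

definition col_edges :: "nat \<Rightarrow> (nat set \<times> nat) set" where
  "col_edges N = {({x, y}, c) | x y c. col_edge N x y c}"

lemma col_edges_iff_adj: "({x, y}, c) \<in> col_edges N \<longleftrightarrow> col_adj N x y c"
  by (auto simp: col_edges_def col_adj_def doubleton_eq_iff)

text \<open>The identity \<open>(x + 2)\<^sup>2 - (x - 2)\<^sup>2 = 8 * x\<close> drives an
  induction in steps of 4; truncated subtraction makes the sum stop by itself.\<close>

lemma sum_minus_4_le: "8 * (\<Sum>j<M. x - 4 * j) \<le> (x + 2)\<^sup>2" for x :: nat
proof (induction M arbitrary: x)
  case 0
  then show ?case by simp
next
  case (Suc M)
  have eq: "(\<Sum>j<Suc M. x - 4 * j) = x + (\<Sum>j<M. (x - 4) - 4 * j)"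
    by (simp del: sum.lessThan_Suc add: sum.lessThan_Suc_shift)
  show ?case
  proof (cases "x \<ge> 4")
    case True
    then obtain t where t: "x = t + 4" using le_Suc_ex[of 4 x] by (auto simp: add.commute)
    have s: "(\<Sum>j<Suc M. x - 4 * j) = (t + 4) + (\<Sum>j<M. t - 4 * j)"
      unfolding eq by (simp add: t)
    have sq: "(x + 2)\<^sup>2 = (t + 2)\<^sup>2 + 8 * (t + 4)"
      by (simp add: t power2_eq_square algebra_simps)
    show ?thesis unfolding s sq using Suc[of t] by simp
  next
    case False
    then have "x = 0 \<or> x = 1 \<or> x = 2 \<or> x = 3" by auto
    then show ?thesis unfolding eq by (auto simp: power2_eq_square)
  qed
qed

lemma card_hub_edges:
  shows "finite {(x, y, c). hub_edge N x y c}"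
    and "8 * card {(x, y, c). hub_edge N x y c} \<le> (N + 2)\<^sup>2"
proof -
  \<comment> \<open>The hubs are \<open>y = N - 1 - 2 * j\<close>, and the partners
    \<open>N - y, ..., y - 2\<close> of such a hub number \<open>N - 3 - 4 * j\<close> (truncated at
    0).\<close>
  let ?T = "SIGMA j:{..<N}. {N - (N - 1 - 2 * j)..<N - 2 - 2 * j}"
  let ?f = "\<lambda>(j, x). (x, N - 1 - 2 * j, x + (N - 1 - 2 * j) + 1 - N)"
  have sub: "{(x, y, c). hub_edge N x y c} \<subseteq> ?f ` ?T"
  proof
    fix t assume "t \<in> {(x, y, c). hub_edge N x y c}"
    then obtain x y c where t: "t = (x, y, c)" and h: "hub_edge N x y c" by auto
    define j where "j = (N - 1 - y) div 2"
    have "odd (N + y)" "y < N" using h by (auto simp: hub_edge_def)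
    then have "2 * j = N - 1 - y" unfolding j_def by presburger
    then have "y = N - 1 - 2 * j" "j < N" using \<open>y < N\<close> by auto
    moreover have "x \<in> {N - y..<y - 1}" "c = x + y + 1 - N" using h by (auto simp: hub_edge_def)
    ultimately have "(j, x) \<in> ?T" "t = ?f (j, x)" by (auto simp: t)
    then show "t \<in> ?f ` ?T" by blast
  qed
  have fin: "finite ?T" by simp
  show "finite {(x, y, c). hub_edge N x y c}"
    by (rule finite_subset[OF sub]) (use fin in simp)
  have "card {(x, y, c). hub_edge N x y c} \<le> card ?T"
    using card_mono[OF _ sub] card_image_le[OF fin, of ?f] fin by fastforce
  also have "card ?T = (\<Sum>j<N. N - 2 - 2 * j - (N - (N - 1 - 2 * j)))"
    by simp
  also have "\<dots> \<le> (\<Sum>j<N. N - 4 * j)"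
    by (intro sum_mono) auto
  finally show "8 * card {(x, y, c). hub_edge N x y c} \<le> (N + 2)\<^sup>2"
    using sum_minus_4_le[of N N] by linarith
qed

lemma card_path_edges:
  shows "finite {(x, y, c). path_edge N x y c}"
    and "card {(x, y, c). path_edge N x y c} \<le> N + 2"
proof -
  have sub: "{(x, y, c). path_edge N x y c} \<subseteq>
      (\<lambda>x. (x, x + 1, x + 2)) ` {..<N} \<union> {(0, N + 1, N + 2), (N, N + 1, N + 3)}" (is "_ \<subseteq> ?A \<union> ?B")
    by (auto simp: path_edge_def)
  show "finite {(x, y, c). path_edge N x y c}"
    by (rule finite_subset[OF sub]) simp
  have "card {(x, y, c). path_edge N x y c} \<le> card (?A \<union> ?B)"
    by (rule card_mono[OF _ sub]) simp
  also have "\<dots> \<le> card ?A + card ?B" by (rule card_Un_le)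
  also have "card ?A \<le> N" using card_image_le[of "{..<N}" "\<lambda>x. (x, x + 1, x + 2)"] by simp
  also have "card ?B \<le> 2" by (simp add: card_insert_if)
  finally show "card {(x, y, c). path_edge N x y c} \<le> N + 2" by simp
qed

text \<open>The cover has one leaf at \<open>0\<close>, \<open>N + 1\<close> leaves at
  \<open>N + 1\<close>, and at most four at every vertex below \<open>N\<close>, one per
  offset.\<close>

lemma card_pendants:
  shows "finite {(x, y, c). pendant N x c \<and> y = leaf N x c}"
    and "card {(x, y, c). pendant N x c \<and> y = leaf N x c} \<le> 5 * N + 2"
proof -
  let ?f = "\<lambda>(x, c). (x, leaf N x c, c)"
  let ?A = "{(0::nat, 1::nat)}" and ?B = "Pair (N + 1) ` {1..N + 1}"
    and ?C = "(\<lambda>(v, d). (v, 2 * v + d - N)) ` ({..<N} \<times> {0, 1, 2, 4::nat})"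
  have sub: "{(x, y, c). pendant N x c \<and> y = leaf N x c} \<subseteq> ?f ` (?A \<union> (?B \<union> ?C))"
  proof
    fix t assume "t \<in> {(x, y, c). pendant N x c \<and> y = leaf N x c}"
    then obtain x c where "t = (x, leaf N x c, c)" and p: "pendant N x c" by blast
    then have t: "t = ?f (x, c)" by simp
    have "(x, c) \<in> ?C"
      if x: "x < N" and d: "c + N \<in> {2 * x, 2 * x + 1, 2 * x + 2, 2 * x + 4}"
    proof -
      obtain d where "d \<in> {0, 1, 2, 4}" "c + N = 2 * x + d"
        using d that by fastforce
      then have "(x, c) = (\<lambda>(v, d). (v, 2 * v + d - N)) (x, d)" "(x, d) \<in> {..<N} \<times> {0, 1, 2, 4}"
        using x by auto
      then show ?thesis by (rule image_eqI)
    qed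
    then have "(x, c) \<in> ?A \<union> (?B \<union> ?C)"
      using p unfolding pendant_def by fastforce
    then show "t \<in> ?f ` (?A \<union> (?B \<union> ?C))" unfolding t by (rule imageI)
  qed
  have fin: "finite (?A \<union> (?B \<union> ?C))" by simp
  show "finite {(x, y, c). pendant N x c \<and> y = leaf N x c}"
    by (rule finite_subset[OF sub]) (use fin in blast)
  have "card {(x, y, c). pendant N x c \<and> y = leaf N x c} \<le> card (?f ` (?A \<union> (?B \<union> ?C)))"
    by (rule card_mono[OF _ sub]) (use fin in blast)
  also have "\<dots> \<le> card (?A \<union> (?B \<union> ?C))" by (rule card_image_le[OF fin])
  also have "\<dots> \<le> card ?A + (card ?B + card ?C)"
    by (rule order_trans[OF card_Un_le add_left_mono[OF card_Un_le]])
  also have "card ?B \<le> N + 1" using card_image_le[of "{1..N + 1}" "Pair (N + 1)"] by simp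
  also have "card ?C \<le> 4 * N"
    using card_image_le[of "{..<N} \<times> {0, 1, 2, 4::nat}" "\<lambda>(v, d). (v, 2 * v + d - N)"] by simp
  finally show "card {(x, y, c). pendant N x c \<and> y = leaf N x c} \<le> 5 * N + 2" by simp
qed

lemma card_col_edges:
  shows "finite (col_edges N)" and "8 * card (col_edges N) \<le> (N + 2)\<^sup>2 + 48 * N + 32"
proof -
  let ?P = "{(x, y, c). path_edge N x y c}" and ?H = "{(x, y, c). hub_edge N x y c}"
    and ?L = "{(x, y, c). pendant N x c \<and> y = leaf N x c}"
  let ?f = "\<lambda>(x, y, c). ({x, y}, c)"
  have eq: "col_edges N = ?f ` (?P \<union> (?H \<union> ?L))"
    unfolding col_edges_def col_edge_def by force
  have fin: "finite (?P \<union> (?H \<union> ?L))"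
    using card_path_edges(1) card_hub_edges(1) card_pendants(1) by blast
  show "finite (col_edges N)" unfolding eq using fin by (rule finite_imageI)
  have "card (col_edges N) \<le> card (?P \<union> (?H \<union> ?L))"
    unfolding eq using fin by (rule card_image_le)
  also have "\<dots> \<le> card ?P + (card ?H + card ?L)"
    by (rule order_trans[OF card_Un_le add_left_mono[OF card_Un_le]])
  \<comment> \<open>The linear part is \<open>8 * ((N + 2) + (5 * N + 2))\<close>, from path edges
    and pendants.\<close>
  finally show "8 * card (col_edges N) \<le> (N + 2)\<^sup>2 + 48 * N + 32"
    using card_path_edges(2)[of N] card_hub_edges(2)[of N] card_pendants(2)[of N] by linarith
qed

section \<open>Running First-Fit on the construction\<close>

lemma col_edges_proper:
  assumes "N > 0" "(e, c) \<in> col_edges N" "(f, c) \<in> col_edges N" "e \<inter> f \<noteq> {}"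
  shows "e = f"
proof -
  obtain v where v: "v \<in> e" "v \<in> f" using assms(4) by auto
  have *: "\<exists>w. e = {v, w} \<and> col_adj N v w c" if "(e, c) \<in> col_edges N" "v \<in> e" for e
    using that by (auto simp: col_edges_def col_adj_def)
  show ?thesis using *[OF assms(2) v(1)] *[OF assms(3) v(2)] col_adj_proper[OF assms(1)] by metis
qed

lemma col_edges_greedy:
  assumes "N > 0" "(e, c) \<in> col_edges N" "1 \<le> q" "q < c"
  shows "\<exists>f. (f, q) \<in> col_edges N \<and> adjacent_edges e f"
proof -
  obtain x y where e: "e = {x, y}" and xy: "col_edge N x y c"
    using assms(2) by (auto simp: col_edges_def)
  obtain u v where uv: "v \<in> {x, y}" "col_adj N v u q"
    using col_edge_greedy[OF assms(1) xy assms(3,4)] by blast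
  then have q: "({v, u}, q) \<in> col_edges N" by (simp add: col_edges_iff_adj)
  \<comment> \<open>One edge cannot have both colors \<open>q < c\<close>, so the edge of color
    \<open>q\<close> found at an end of \<open>e\<close> is a different one.\<close>
  have "{v, u} \<noteq> e"
  proof
    assume "{v, u} = e"
    then have "col_adj N x y q" using q by (simp add: e col_edges_iff_adj)
    then have "col_edge N x y q"
      using col_edge_less[OF assms(1)] xy unfolding col_adj_def by (meson not_less_iff_gr_or_eq)
    then show False using col_edge_fun[OF assms(1) xy] assms(4) by blast
  qed
  then show ?thesis using q uv by (auto simp: adjacent_edges_def e)
qed

lemma col_edges_fun:
  assumes "N > 0" "(e, c) \<in> col_edges N" "(e, d) \<in> col_edges N"
  shows "c = d"
proof -
  obtain x y where e: "e = {x, y}" and xy: "col_edge N x y c"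
    using assms(2) by (auto simp: col_edges_def)
  have "col_adj N x y d" using assms(3) by (simp add: e col_edges_iff_adj)
  then have "col_edge N x y d"
    using col_edge_less[OF assms(1)] xy unfolding col_adj_def by (meson not_less_iff_gr_or_eq)
  then show ?thesis using col_edge_fun[OF assms(1) xy] by blast
qed

lemma rainbow_cycle_upper_bound:
  assumes "k \<ge> 3"
  obtains es and G :: "nat ugraph" and S
  where "distinct es" "simple_graph G" "edges G = set es" "is_copy S (cycle_graph k) G"
    "rainbow (first_fit_coloring es) S" "8 * length es \<le> k\<^sup>2 + 48 * k"
proof -
  define N where "N = k - 2"
  have N: "N > 0" "k = N + 2" using assms by (auto simp: N_def)
  obtain es where es: "distinct es" "set es = fst ` col_edges N" "length es = card (col_edges N)"
    "\<And>e c. first_fit_coloring es e = Some c \<longleftrightarrow> (e, c) \<in> col_edges N"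
  proof (rule first_fit_coloring_realize[of "col_edges N"])
    show "finite (col_edges N)" by (rule card_col_edges)
    show "1 \<le> c" if "(e, c) \<in> col_edges N" for e c
      using that col_edge_pos by (auto simp: col_edges_def)
    show "c = d" if "(e, c) \<in> col_edges N" "(e, d) \<in> col_edges N" for e c d
      using col_edges_fun[OF N(1) that] .
    show "e = f" if "(e, c) \<in> col_edges N" "(f, c) \<in> col_edges N" "e \<inter> f \<noteq> {}" for e f c
      using col_edges_proper[OF N(1) that] .
    show "\<exists>f. (f, q) \<in> col_edges N \<and> adjacent_edges e f"
      if "(e, c) \<in> col_edges N" "1 \<le> q" "q < c" for e c q
      using col_edges_greedy[OF N(1) that] .
  qed (rule that)
  have card2: "finite e \<and> card e = 2" if "e \<in> set es" for e
    using that col_edge_less[OF N(1)] by (force simp: es(2) col_edges_def)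
  define G :: "nat ugraph" where "G = \<lparr>verts = {..<k} \<union> \<Union>(set es), edges = set es\<rparr>"
  \<comment> \<open>The last two colors are out of order along the cycle: the edge from
    \<open>N\<close> to \<open>N + 1\<close> takes \<open>N + 3\<close> and needs the closing edge
    to supply \<open>N + 2\<close>.\<close>
  define col where "col i = (if i < N then i + 2 else if i = N then N + 3 else N + 2)" for i
  have cyc: "({i, (i + 1) mod k}, col i) \<in> col_edges N" if "i < k" for i
  proof -
    consider "i < N" | "i = N" | "i = N + 1" using \<open>i < k\<close> N(2) by linarith
    then have "path_edge N i ((i + 1) mod k) (col i) \<or> path_edge N ((i + 1) mod k) i (col i)"
      by cases (auto simp: path_edge_def col_def N)
    then show ?thesis by (auto simp: col_edges_iff_adj col_adj_def col_edge_def)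
  qed
  have cycE: "edges (cycle_graph k) = (\<lambda>i. {i, (i + 1) mod k}) ` {..<k}"
    by (auto simp: cycle_graph_def)
  have sub: "edges (cycle_graph k) \<subseteq> set es"
    unfolding cycE es(2) using cyc by force
  show thesis
  proof (rule that)
    show "distinct es" by (rule es)
    show "simple_graph G" using card2 by (auto simp: simple_graph_def G_def)
    show "edges G = set es" by (simp add: G_def)
    have "simple_graph (cycle_graph k)"
      using sub card2 N by (auto simp: simple_graph_def cycle_graph_def)
    then show "is_copy (cycle_graph k) (cycle_graph k) G"
      using sub unfolding is_copy_def subgraph_def isomorphic_def
      by (auto simp: G_def cycle_graph_def intro!: exI[of _ id])
    show "rainbow (first_fit_coloring es) (cycle_graph k)"
      unfolding rainbow_def
    proof
      show "edges (cycle_graph k) \<subseteq> dom (first_fit_coloring es)"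
        using sub by (simp add: dom_first_fit_coloring)
      have "first_fit_coloring es {i, (i + 1) mod k} = Some (col i)" if "i < k" for i
        using cyc[OF that] es(4) by blast
      moreover have "inj_on col {..<k}"
        by (auto simp: inj_on_def col_def N split: if_splits)
      ultimately show "inj_on (first_fit_coloring es) (edges (cycle_graph k))"
        unfolding cycE by (auto simp: inj_on_def)
    qed
    show "8 * length es \<le> k\<^sup>2 + 48 * k"
      using card_col_edges(2)[of N] unfolding es(3) N(2) by simp
  qed
qed

section \<open>Two-sided bounds and asymptotics\<close>

lemma AR_FF_cycle_bounds:
  assumes "k \<ge> 3"
  obtains t where "AR_FF (cycle_graph k) = enat t" "k\<^sup>2 \<le> 8 * t" "8 * t \<le> k\<^sup>2 + 48 * k"
proof -
  define A where "A = {enat (length es) | es.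
     distinct es \<and>
     (\<exists>G :: nat ugraph. simple_graph G \<and> edges G = set es \<and>
        (\<exists>S. is_copy S (cycle_graph k) G \<and> rainbow (first_fit_coloring es) S))}"
  obtain es and G :: "nat ugraph" and S where *: "distinct es" "simple_graph G" "edges G = set es"
    "is_copy S (cycle_graph k) G" "rainbow (first_fit_coloring es) S"
    and "8 * length es \<le> k\<^sup>2 + 48 * k"
    using rainbow_cycle_upper_bound[OF assms] by blast
  then have es: "enat (length es) \<in> A" "8 * length es \<le> k\<^sup>2 + 48 * k"
    unfolding A_def by blast+
  \<comment> \<open>The infimum of a nonempty set of extended naturals is attained, so the lower
    bound applies to an actual sequence of edges.\<close>
  have "Inf A \<in> A" using es(1) by (auto simp: Inf_enat_def intro: LeastI)
  then obtain t where t: "Inf A = enat t" "enat t \<in> A" by (auto simp: A_def)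
  show thesis
  proof (rule that)
    show "AR_FF (cycle_graph k) = enat t" using t(1) by (simp add: AR_FF_def A_def)
    show "k\<^sup>2 \<le> 8 * t"
      using t(2) rainbow_cycle_lower_bound[OF assms] by (auto simp: A_def)
    have "enat t \<le> enat (length es)" unfolding t(1)[symmetric] using es(1) by (rule Inf_lower)
    then show "8 * t \<le> k\<^sup>2 + 48 * k" using es(2) by simp
  qed
qed

theorem theorem14:
  "\<exists>\<epsilon> :: nat \<Rightarrow> real. \<epsilon> \<longlonglongrightarrow> 0 \<and>
     (\<forall>k\<ge>3. ereal_of_enat (AR_FF (cycle_graph k)) = ereal ((real k)\<^sup>2 / 8 * (1 + \<epsilon> k)))"
proof -
  have "\<forall>k. \<exists>t. k \<ge> 3 \<longrightarrow>
      AR_FF (cycle_graph k) = enat t \<and> k\<^sup>2 \<le> 8 * t \<and> 8 * t \<le> k\<^sup>2 + 48 * k"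
    using AR_FF_cycle_bounds by metis
  then obtain t where t: "\<And>k. k \<ge> 3 \<Longrightarrow>
      AR_FF (cycle_graph k) = enat (t k) \<and> k\<^sup>2 \<le> 8 * t k \<and> 8 * t k \<le> k\<^sup>2 + 48 * k"
    by metis
  \<comment> \<open>Solving for the error term makes the equation exact for
    \<open>k \<ge> 3\<close>; the bounds on \<open>t\<close> squeeze it between 0 and
    \<open>48 / k\<close>.\<close>
  define \<epsilon> where "\<epsilon> k = 8 * real (t k) / (real k)\<^sup>2 - 1" for k
  have bounds: "0 \<le> \<epsilon> k \<and> \<epsilon> k \<le> 48 / real k" if "k \<ge> 3" for k
  proof -
    have "real (k\<^sup>2) \<le> real (8 * t k)" "real (8 * t k) \<le> real (k\<^sup>2 + 48 * k)"
      using t[OF that] of_nat_le_iff by blast+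
    then have "(real k)\<^sup>2 \<le> 8 * real (t k)" "8 * real (t k) - (real k)\<^sup>2 \<le> 48 * real k"
      by simp_all
    moreover have "\<epsilon> k = (8 * real (t k) - (real k)\<^sup>2) / (real k)\<^sup>2"
      "48 / real k = 48 * real k / (real k)\<^sup>2"
      using that by (simp_all add: \<epsilon>_def diff_divide_distrib power2_eq_square)
    ultimately show ?thesis
      using divide_right_mono[of _ "48 * real k" "(real k)\<^sup>2"] by simp
  qed
  have "\<epsilon> \<longlonglongrightarrow> 0"
  proof (rule tendsto_sandwich[of "\<lambda>_. 0" _ _ "\<lambda>k. 48 / real k"])
    show "eventually (\<lambda>k. 0 \<le> \<epsilon> k) sequentially" "eventually (\<lambda>k. \<epsilon> k \<le> 48 / real k) sequentially"
      using bounds by (auto intro: eventually_sequentiallyI[of 3])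
    show "(\<lambda>k. 48 / real k) \<longlonglongrightarrow> 0" by (rule lim_const_over_n)
  qed simp
  moreover have "ereal_of_enat (AR_FF (cycle_graph k)) = ereal ((real k)\<^sup>2 / 8 * (1 + \<epsilon> k))"
    if "k \<ge> 3" for k
    using t[OF that] that by (simp add: \<epsilon>_def)
  ultimately show ?thesis by blast
qed

end
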